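(* Let $G$ be a graph of order $n\geq 2$ and let $\mu(G)$ be its spectral radius. If $$\mu(G)\geq n-2,$$ then $G$ contains a Hamiltonian path unless $G=K_{n-1}+v$. If the inequality is strict, that is, $\mu(G)>n-2$, then $G$ contains a Hamiltonian cycle unless $G=K_{n-1}+e$.
   Context: Graphs are finite, simple and undirected; the order of a graph is its number of vertices. The spectral radius $\mu(G)$ is the largest eigenvalue of the adjacency matrix of $G$. $K_{n-1}+v$ denotes the graph of order $n$ consisting of the complete graph on $n-1$ vertices together with an isolated vertex. $K_{n-1}+e$ denotes the graph of order $n$ consisting of the complete graph on $n-1$ vertices with a pendent edge (i.e. one additional vertex joined to exactly one vertex of the complete graph). Equality of graphs means isomorphism. A Hamiltonian path (cycle) is a path (cycle) in $G$ passing through all vertices of $G$; a cycle has at least $3$ vertices. *)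

theory Defs
  imports
    "Graph_Theory.Graph_Theory"
    "Jordan_Normal_Form.Spectral_Radius"
begin

text \<open>
  A finite simple undirected graph is a \<open>graph\<close> of the entry \<open>Graph_Theory\<close>: a finite
  symmetric digraph without loops and multiple arcs, an undirected edge being a pair of
  opposite arcs.
\<close>

definition adjacency_matrix :: "('a, 'b) pre_digraph \<Rightarrow> 'a list \<Rightarrow> real mat" where
  "adjacency_matrix G vs =
     mat (length vs) (length vs) (\<lambda>(i, j). if vs ! i \<rightarrow>\<^bsub>G\<^esub> vs ! j then 1 else 0)"

text \<open>
  The eigenvalues do not depend on the order in which the vertices are listed, see
  \<open>adjacency_spectrum_eq\<close>. As the matrix is real and symmetric, all of its eigenvalues are real,
  so for a nonempty finite vertex set the maximum below is taken over a finite nonempty set.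
\<close>

definition adjacency_spectrum :: "('a, 'b) pre_digraph \<Rightarrow> real set" where
  "adjacency_spectrum G =
     spectrum (adjacency_matrix G (SOME vs. distinct vs \<and> set vs = verts G))"

definition graph_spectral_radius :: "('a, 'b) pre_digraph \<Rightarrow> real" where
  "graph_spectral_radius G = Max (adjacency_spectrum G)"

lemma spectrum_adjacency_matrix:
  assumes "distinct vs" "set vs = verts G"
  shows "spectrum (adjacency_matrix G vs) =
    {k. \<exists>x. (\<exists>u \<in> verts G. x u \<noteq> 0) \<and>
       (\<forall>u \<in> verts G. (\<Sum>w \<in> verts G. if u \<rightarrow>\<^bsub>G\<^esub> w then x w else 0) = k * x u)}"
proof (rule Set.set_eqI, rule iffI)
  let ?n = "length vs"
  let ?A = "adjacency_matrix G vs"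
  have bij: "bij_betw ((!) vs) {0..<?n} (verts G)"
    using bij_betw_nth[OF assms(1), of "{0..<?n}" "verts G"] assms(2) by (simp add: atLeast0LessThan)
  have row: "(?A *\<^sub>v vec ?n (\<lambda>i. x (vs ! i))) $ i =
      (\<Sum>w \<in> verts G. if vs ! i \<rightarrow>\<^bsub>G\<^esub> w then x w else 0)" if "i < ?n" for i x
  proof -
    have "(?A *\<^sub>v vec ?n (\<lambda>i. x (vs ! i))) $ i =
        (\<Sum>j = 0..<?n. if vs ! i \<rightarrow>\<^bsub>G\<^esub> vs ! j then x (vs ! j) else 0)"
      using that unfolding adjacency_matrix_def
      by (auto simp: scalar_prod_def intro!: sum.cong)
    also have "\<dots> = (\<Sum>w \<in> verts G. if vs ! i \<rightarrow>\<^bsub>G\<^esub> w then x w else 0)"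
      by (rule sum.reindex_bij_betw[OF bij])
    finally show ?thesis .
  qed
  {
    fix k assume "k \<in> spectrum ?A"
    then obtain v where v: "eigenvector ?A v k"
      by (auto simp: spectrum_def eigenvalue_def)
    have dim: "dim_vec v = ?n" and nz: "v \<noteq> 0\<^sub>v ?n" and eq: "?A *\<^sub>v v = k \<cdot>\<^sub>v v"
      using v by (auto simp: eigenvector_def adjacency_matrix_def)
    define x where "x u = v $ (the_inv_into {0..<?n} ((!) vs) u)" for u
    have inj: "inj_on ((!) vs) {0..<?n}" using bij by (rule bij_betw_imp_inj_on)
    have x: "x (vs ! i) = v $ i" if "i < ?n" for i
      using that by (simp add: x_def the_inv_into_f_f[OF inj])
    have vx: "v = vec ?n (\<lambda>i. x (vs ! i))"
      by (rule eq_vecI) (auto simp: dim x)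
    obtain i where i: "i < ?n" "v $ i \<noteq> 0"
    proof (rule ccontr)
      assume "\<not> thesis"
      hence "\<And>i. i < ?n \<Longrightarrow> v $ i = 0" using that by blast
      hence "v = 0\<^sub>v ?n" by (intro eq_vecI) (auto simp: dim)
      thus False using nz by blast
    qed
    have "\<exists>u \<in> verts G. x u \<noteq> 0"
    proof
      show "x (vs ! i) \<noteq> 0" using i x by simp
      show "vs ! i \<in> verts G" using i(1) assms(2) nth_mem by blast
    qed
    moreover have "(\<Sum>w \<in> verts G. if u \<rightarrow>\<^bsub>G\<^esub> w then x w else 0) = k * x u"
      if u: "u \<in> verts G" for u
    proof -
      obtain i where i: "i < ?n" "u = vs ! i"
        using u by (auto simp: assms(2)[symmetric] in_set_conv_nth)
      have "(\<Sum>w \<in> verts G. if u \<rightarrow>\<^bsub>G\<^esub> w then x w else 0) = (?A *\<^sub>v v) $ i"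
        unfolding i(2) vx by (rule row[OF i(1), symmetric])
      also have "\<dots> = k * x u"
        using i dim x by (simp add: eq)
      finally show ?thesis .
    qed
    ultimately show "k \<in> {k. \<exists>x. (\<exists>u \<in> verts G. x u \<noteq> 0) \<and>
       (\<forall>u \<in> verts G. (\<Sum>w \<in> verts G. if u \<rightarrow>\<^bsub>G\<^esub> w then x w else 0) = k * x u)}"
      by blast
  }
  {
    fix k :: real
    assume "k \<in> {k. \<exists>x. (\<exists>u \<in> verts G. x u \<noteq> 0) \<and>
       (\<forall>u \<in> verts G. (\<Sum>w \<in> verts G. if u \<rightarrow>\<^bsub>G\<^esub> w then x w else 0) = k * x u)}"
    then obtain x u where u: "u \<in> verts G" "x u \<noteq> 0"
      and eq: "\<And>u. u \<in> verts G \<Longrightarrow>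
        (\<Sum>w \<in> verts G. if u \<rightarrow>\<^bsub>G\<^esub> w then x w else 0) = k * x u"
      by blast
    let ?v = "vec ?n (\<lambda>i. x (vs ! i))"
    obtain i where i: "i < ?n" "u = vs ! i"
      using u(1) by (auto simp: assms(2)[symmetric] in_set_conv_nth)
    have "?v $ i \<noteq> 0" using i u by simp
    hence "?v \<noteq> 0\<^sub>v ?n" using index_zero_vec(1)[OF i(1)] by force
    moreover have "?A *\<^sub>v ?v = k \<cdot>\<^sub>v ?v"
    proof (rule eq_vecI)
      fix i assume "i < dim_vec (k \<cdot>\<^sub>v ?v)"
      hence i: "i < ?n" by simp
      hence "vs ! i \<in> verts G" using assms(2) nth_mem by blast
      with i show "(?A *\<^sub>v ?v) $ i = (k \<cdot>\<^sub>v ?v) $ i"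
        by (simp add: row eq del: index_mult_mat_vec)
    qed (simp add: adjacency_matrix_def)
    ultimately have "eigenvector ?A ?v k"
      by (simp add: eigenvector_def adjacency_matrix_def)
    thus "k \<in> spectrum ?A"
      by (auto simp: spectrum_def eigenvalue_def)
  }
qed

lemma adjacency_spectrum_eq:
  assumes "distinct vs" "set vs = verts G"
  shows "adjacency_spectrum G = spectrum (adjacency_matrix G vs)"
proof -
  have "distinct (SOME vs. distinct vs \<and> set vs = verts G) \<and>
      set (SOME vs. distinct vs \<and> set vs = verts G) = verts G"
    by (rule someI[of "\<lambda>vs. distinct vs \<and> set vs = verts G" vs]) (simp add: assms)
  thus ?thesis
    unfolding adjacency_spectrum_def
    by (simp add: spectrum_adjacency_matrix assms)
qed

definition (in pre_digraph) has_hamiltonian_path :: bool where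
  "has_hamiltonian_path \<longleftrightarrow>
     (\<exists>u p v. apath u p v \<and> set (awalk_verts u p) = verts G)"

text \<open>
  In a symmetric digraph an edge traversed back and forth counts as a \<open>cycle\<close>, so the
  minimal length 3 is required explicitly.
\<close>

definition (in pre_digraph) has_hamiltonian_cycle :: bool where
  "has_hamiltonian_cycle \<longleftrightarrow>
     (\<exists>u p. cycle p \<and> 3 \<le> length p \<and> awalk u p u \<and> set (awalk_verts u p) = verts G)"

definition complete_graph :: "nat \<Rightarrow> nat pair_pre_digraph" where
  "complete_graph m = \<lparr> pverts = {..<m}, parcs = {(i, j). i < m \<and> j < m \<and> i \<noteq> j} \<rparr>"

text \<open>
  In the next two graphs the additional vertex is \<open>m\<close>, so their order is \<open>m + 1\<close>; the second
  one is meant for \<open>m \<ge> 1\<close>, so that 0 is a vertex of the complete graph.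
\<close>

definition complete_plus_vertex :: "nat \<Rightarrow> nat pair_pre_digraph" where
  "complete_plus_vertex m =
     \<lparr> pverts = insert m (pverts (complete_graph m)), parcs = parcs (complete_graph m) \<rparr>"

definition complete_plus_edge :: "nat \<Rightarrow> nat pair_pre_digraph" where
  "complete_plus_edge m =
     \<lparr> pverts = insert m (pverts (complete_graph m)),
       parcs = parcs (complete_graph m) \<union> {(0, m), (m, 0)} \<rparr>"

lemma complete_digraph_complete_graph: "complete_digraph m (with_proj (complete_graph m))"
  by (auto simp: complete_digraph_pair_def complete_graph_def)

lemma pair_graph_complete_plus_vertex: "pair_graph (complete_plus_vertex m)"
proof -
  have "finite {(i, j). i < m \<and> j < m \<and> i \<noteq> j}"
    by (rule finite_subset[of _ "{..<m} \<times> {..<m}"]) auto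
  thus ?thesis
    by unfold_locales (auto simp: complete_plus_vertex_def complete_graph_def symmetric_def
      arcs_ends_conv intro!: symI)
qed

lemma pair_graph_complete_plus_edge: "1 \<le> m \<Longrightarrow> pair_graph (complete_plus_edge m)"
proof -
  assume "1 \<le> m"
  moreover have "finite {(i, j). i < m \<and> j < m \<and> i \<noteq> j}"
    by (rule finite_subset[of _ "{..<m} \<times> {..<m}"]) auto
  ultimately show ?thesis
    by unfold_locales (auto simp: complete_plus_edge_def complete_graph_def symmetric_def
      arcs_ends_conv intro!: symI)
qed

end

theory Submission
  imports Defs
begin

text \<open>
  The spectral radius enters only through the number of edges. Scale an eigenvector for the
  eigenvalue \<open>k\<close> so that its largest entry is 1, at the vertex \<open>u\<close>. Evaluating \<open>A\<close> and \<open>A\<^sup>2\<close> at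
  \<open>u\<close> bounds \<open>k\<^sup>2 + k\<close> by the sum of the degrees of \<open>u\<close> and of its neighbours, hence by the sum
  of all degrees (\<open>eigenvalue_le_degree_sum\<close>). So \<open>k \<ge> n - 2\<close> forces the degree sum to be at
  least \<open>(n - 1) (n - 2)\<close>, and a strict inequality carries over.

  The rest is extremal graph theory. If the degree sum exceeds \<open>(n - 1) (n - 2)\<close>, fewer than
  \<open>n - 1\<close> edges are missing. Either Ore's condition holds, and the graph is Hamiltonian, or two
  nonadjacent vertices \<open>u\<close> and \<open>v\<close> have degree sum \<open>n - 1\<close>, and then all missing edges meet \<open>u\<close>
  or \<open>v\<close>: the remaining vertices form a clique. There a Hamiltonian cycle can be written down
  unless \<open>u\<close> or \<open>v\<close> is pendent, which is the exception \<open>K\<^sub>n\<^sub>-\<^sub>1 + e\<close>, or \<open>n = 5\<close> and \<open>u\<close>, \<open>v\<close> have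
  the same two neighbours (\<open>hamiltonian_if_many_edges\<close>). The latter graph has three independent
  vertices, and weighting the vertices shows that its spectral radius is at most 3
  (\<open>eigenvalue_independent\<close>), so the strict inequality excludes it.

  A graph has a Hamiltonian path iff the cone over it has a Hamiltonian cycle. Coning adds \<open>2 n\<close>
  to the degree sum, so a degree sum of at least \<open>(n - 1) (n - 2)\<close> becomes one above
  \<open>n (n - 1)\<close>, and the path statement follows from the cycle statement
  (\<open>hamiltonian_path_if_many_edges\<close>). Its exceptions are \<open>K\<^sub>n\<^sub>-\<^sub>1 + v\<close> and graphs of order 4 with
  three independent vertices, whose spectral radius is less than 2.
\<close>

section \<open>Ore's theorem\<close>

definition gap :: "('a \<Rightarrow> 'a \<Rightarrow> bool) \<Rightarrow> 'a \<Rightarrow> 'a \<Rightarrow> nat" where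
  "gap E x y = (if E x y then 0 else 1)"

fun gaps :: "('a \<Rightarrow> 'a \<Rightarrow> bool) \<Rightarrow> 'a list \<Rightarrow> nat" where
  "gaps E (x # y # xs) = gap E x y + gaps E (y # xs)"
| "gaps E _ = 0"

definition circular_gaps :: "('a \<Rightarrow> 'a \<Rightarrow> bool) \<Rightarrow> 'a list \<Rightarrow> nat" where
  "circular_gaps E xs = gaps E xs + gap E (last xs) (hd xs)"

lemma gaps_append:
  assumes "xs \<noteq> []" "ys \<noteq> []"
  shows "gaps E (xs @ ys) = gaps E xs + gap E (last xs) (hd ys) + gaps E ys"
  using assms
proof (induction xs rule: induct_list012)
  case (2 x)
  then show ?case by (cases ys) auto
qed auto

lemma gaps_rev:
  assumes "\<And>x y. E x y = E y x"
  shows "gaps E (rev xs) = gaps E xs"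
proof (induction xs rule: induct_list012)
  case (3 x y zs)
  then show ?case
    using gaps_append[of "rev zs @ [y]" "[x]" E] assms[of x y] by (simp add: gap_def)
qed auto

lemma split_at_gap:
  assumes "\<not> successively E xs"
  obtains ys zs where "xs = ys @ zs" "ys \<noteq> []" "zs \<noteq> []" "\<not> E (last ys) (hd zs)"
  using assms
proof (induction xs arbitrary: thesis rule: induct_list012)
  case (3 x y zs)
  show ?case
  proof (cases "E x y")
    case True
    with 3 obtain us vs where uv: "y # zs = us @ vs" "us \<noteq> []" "vs \<noteq> []" "\<not> E (last us) (hd vs)"
      by (metis successively.simps(3))
    then show ?thesis using "3.prems"(1)[of "x # us" vs] by simp
  next
    case False
    then show ?thesis using "3.prems"(1)[of "[x]" "y # zs"] by simp
  qed
qed auto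

lemma circular_gaps_rotate:
  assumes "xs \<noteq> []" "ys \<noteq> []"
  shows "circular_gaps E (ys @ xs) = circular_gaps E (xs @ ys)"
  using assms by (simp add: circular_gaps_def gaps_append)

locale adjacency =
  fixes V :: "'a set" and E :: "'a \<Rightarrow> 'a \<Rightarrow> bool"
  assumes finite_V: "finite V"
    and sym_E: "E x y \<Longrightarrow> E y x"
    and irrefl_E: "\<not> E x x"
begin

definition nbs :: "'a \<Rightarrow> 'a set" where
  "nbs x = {y \<in> V. E x y}"

abbreviation deg :: "'a \<Rightarrow> nat" where
  "deg x \<equiv> card (nbs x)"

text \<open>
  The two ends of a single edge count as a circuit here, so that Ore's theorem holds from order 2.
\<close>

definition hamiltonian_circuit :: "'a list \<Rightarrow> bool" where
  "hamiltonian_circuit xs \<longleftrightarrow>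
     distinct xs \<and> set xs = V \<and> successively E xs \<and> E (last xs) (hd xs)"

definition clique :: "'a set \<Rightarrow> bool" where
  "clique S \<longleftrightarrow> (\<forall>x\<in>S. \<forall>y\<in>S. x \<noteq> y \<longrightarrow> E x y)"

definition independent :: "'a set \<Rightarrow> bool" where
  "independent S \<longleftrightarrow> (\<forall>x\<in>S. \<forall>y\<in>S. \<not> E x y)"

lemma finite_nbs [simp]: "finite (nbs x)"
  using finite_V by (simp add: nbs_def)

lemma E_commute: "E x y = E y x"
  using sym_E by blast

text \<open>
  The exchange step. By the pigeonhole principle some consecutive pair \<open>x\<close>, \<open>y\<close> in the list has
  \<open>y\<close> adjacent to the first vertex and \<open>x\<close> adjacent to the last one. Reversing the part from \<open>y\<close>
  onwards replaces the closing gap and the pair \<open>x\<close>, \<open>y\<close> by two edges.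
\<close>

lemma fewer_gaps_if_Ore:
  assumes xs: "distinct xs" "set xs = V" and V: "2 \<le> card V"
    and nonadj: "\<not> E (last xs) (hd xs)"
    and deg: "card V \<le> deg (hd xs) + deg (last xs)"
  obtains ys where "distinct ys" "set ys = V" "circular_gaps E ys < circular_gaps E xs"
proof -
  let ?n = "length xs"
  have n: "?n = card V" using xs distinct_card by force
  \<comment> \<open>\<open>A\<close> and \<open>B\<close> record the positions of the neighbours of the two end vertices, those of the
    first one shifted by 1, so that both live in a set of size \<open>card V - 1\<close>.\<close>
  define A where "A = {i. i < ?n - 1 \<and> E (hd xs) (xs ! Suc i)}"
  define B where "B = {i. i < ?n - 1 \<and> E (last xs) (xs ! i)}"
  have ne: "xs \<noteq> []" and hd: "hd xs = xs ! 0" and last: "last xs = xs ! (?n - 1)"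
    using n V by (cases "xs = []"; simp add: hd_conv_nth last_conv_nth)+
  have "nbs (hd xs) \<subseteq> (\<lambda>i. xs ! Suc i) ` A"
  proof
    fix y assume y: "y \<in> nbs (hd xs)"
    then obtain i where i: "i < ?n" "y = xs ! i"
      using xs by (auto simp: nbs_def in_set_conv_nth)
    then obtain j where "i = Suc j" using y irrefl_E hd by (cases i) (auto simp: nbs_def)
    then show "y \<in> (\<lambda>i. xs ! Suc i) ` A" using i y by (auto simp: A_def nbs_def)
  qed
  then have cA: "deg (hd xs) \<le> card A"
    by (rule surj_card_le[rotated]) (simp add: A_def)
  have "nbs (last xs) \<subseteq> (\<lambda>i. xs ! i) ` B"
  proof
    fix y assume y: "y \<in> nbs (last xs)"
    then obtain i where i: "i < ?n" "y = xs ! i"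
      using xs by (auto simp: nbs_def in_set_conv_nth)
    moreover have "i \<noteq> ?n - 1" using y irrefl_E i last by (auto simp: nbs_def)
    ultimately show "y \<in> (\<lambda>i. xs ! i) ` B" using y by (auto simp: B_def nbs_def)
  qed
  then have cB: "deg (last xs) \<le> card B"
    by (rule surj_card_le[rotated]) (simp add: B_def)
  have "A \<inter> B \<noteq> {}"
  proof
    assume "A \<inter> B = {}"
    then have "card A + card B = card (A \<union> B)"
      by (intro card_Un_disjoint[symmetric]) (auto simp: A_def B_def)
    also have "\<dots> \<le> card {..<?n - 1}"
      by (rule card_mono) (auto simp: A_def B_def)
    finally show False using cA cB deg n V by simp
  qed
  then obtain i where i: "i < ?n - 1" "E (hd xs) (xs ! Suc i)" "E (last xs) (xs ! i)"
    by (auto simp: A_def B_def)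
  define us where "us = take (Suc i) xs"
  define vs where "vs = drop (Suc i) xs"
  have xs_eq: "xs = us @ vs" by (simp add: us_def vs_def)
  have uv: "us \<noteq> []" "vs \<noteq> []" using i ne by (auto simp: us_def vs_def)
  have "last us = xs ! i" using i by (simp add: us_def take_Suc_conv_app_nth)
  moreover have "hd vs = xs ! Suc i" using i by (simp add: vs_def hd_drop_conv_nth)
  moreover have "hd xs = hd us" "last xs = last vs" using uv xs_eq by auto
  ultimately have adj: "E (hd us) (hd vs)" "E (last vs) (last us)"
    and nadj: "\<not> E (last vs) (hd us)"
    using i nonadj by auto
  have "circular_gaps E (us @ rev vs) < circular_gaps E xs"
    using uv adj nadj unfolding xs_eq circular_gaps_def
    by (simp add: gaps_append gaps_rev[OF E_commute] gap_def last_rev hd_rev E_commute)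
  then show thesis using that[of "us @ rev vs"] xs xs_eq by auto
qed

text \<open>
  An enumeration of the vertices with the least number of circular gaps has none: a gap could be
  rotated to the closing position and then removed by the exchange step.
\<close>

theorem Ore:
  assumes V: "2 \<le> card V"
    and deg: "\<And>u v. \<lbrakk>u \<in> V; v \<in> V; u \<noteq> v; \<not> E u v\<rbrakk> \<Longrightarrow> card V \<le> deg u + deg v"
  shows "\<exists>xs. hamiltonian_circuit xs"
proof -
  let ?P = "\<lambda>xs. distinct xs \<and> set xs = V"
  obtain xs0 where "?P xs0" using finite_distinct_list[OF finite_V] by blast
  then obtain xs where xs: "?P xs"
    and min: "\<And>ys. ?P ys \<Longrightarrow> circular_gaps E xs \<le> circular_gaps E ys"
    using ex_has_least_nat[of ?P xs0 "circular_gaps E"] by blast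
  have no_gap: "E (last ys) (hd ys)" if ys: "?P ys" "circular_gaps E ys = circular_gaps E xs" for ys
  proof (rule ccontr)
    assume na: "\<not> E (last ys) (hd ys)"
    have len: "2 \<le> length ys" using ys(1) V distinct_card by force
    then have ne: "hd ys \<noteq> last ys"
      using ys(1) by (cases ys) (auto split: if_splits)
    have "ys \<noteq> []" using len by auto
    then have "hd ys \<in> V" "last ys \<in> V" using ys(1) by auto
    then have "card V \<le> deg (hd ys) + deg (last ys)"
      using deg[of "hd ys" "last ys"] ne na E_commute by auto
    then show False
      using fewer_gaps_if_Ore[of ys] ys min V na by (metis not_less)
  qed
  have "successively E xs"
  proof (rule ccontr)
    assume "\<not> successively E xs"
    then obtain ys zs where yz: "xs = ys @ zs" "ys \<noteq> []" "zs \<noteq> []" "\<not> E (last ys) (hd zs)"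
      by (rule split_at_gap)
    have "E (last (zs @ ys)) (hd (zs @ ys))"
      using xs yz by (intro no_gap) (auto simp: circular_gaps_rotate)
    then show False using yz by simp
  qed
  then show ?thesis using no_gap[of xs] xs by (auto simp: hamiltonian_circuit_def)
qed

section \<open>Circuits in graphs with many edges\<close>

lemma successively_if_clique:
  assumes "clique (set xs)" "distinct xs"
  shows "successively E xs"
  using assms by (induction xs rule: induct_list012) (auto simp: clique_def)

text \<open>
  If Ore's theorem does not apply, take nonadjacent vertices \<open>u\<close>, \<open>v\<close> of small degree sum and let
  \<open>S\<close> be the set of the other \<open>k\<close> vertices. The edges inside \<open>S\<close> and those at \<open>u\<close> or \<open>v\<close> can
  only reach the required number if \<open>deg u + deg v = k + 1\<close> and \<open>S\<close> is a clique. As both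
  neighbourhoods lie in \<open>S\<close>, they share a vertex \<open>b\<close>. If \<open>u\<close> and \<open>v\<close> have further neighbours
  \<open>a \<noteq> c\<close>, the circuit is \<open>u, b, v, c, \<dots>, a\<close>, running through the rest of the clique.
\<close>

theorem hamiltonian_if_many_edges:
  assumes V: "2 \<le> card V" and edges: "(card V - 1) * (card V - 2) < (\<Sum>x\<in>V. deg x)"
  shows "(\<exists>xs. hamiltonian_circuit xs) \<or>
    (\<exists>w\<in>V. deg w = 1 \<and> clique (V - {w})) \<or>
    (card V = 5 \<and> (\<exists>T\<subseteq>V. card T = 3 \<and> independent T))"
proof (rule ccontr)
  assume contra: "\<not> ?thesis"
  then obtain u v where uv: "u \<in> V" "v \<in> V" "u \<noteq> v" "\<not> E u v" and small: "deg u + deg v < card V"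
    using Ore[OF V] by (meson not_less)
  define S where "S = V - {u, v}"
  define k where "k = card S"
  have fS: "finite S" using finite_V by (simp add: S_def)
  have cV: "card V = k + 2"
    using uv V finite_V unfolding k_def S_def by (simp add: card_Diff_subset)
  have V_eq: "V = insert u (insert v S)" and uvS: "u \<notin> S" "v \<notin> S"
    using uv by (auto simp: S_def)
  have sub: "nbs u \<subseteq> S" "nbs v \<subseteq> S"
    using uv irrefl_E E_commute by (auto simp: S_def nbs_def)
  \<comment> \<open>Edges between \<open>S\<close> and \<open>u\<close>, \<open>v\<close> are counted from both ends, hence the factor 2 in \<open>total\<close>.\<close>
  have into: "(\<Sum>x\<in>S. of_bool (E x w)) = deg w" if "nbs w \<subseteq> S" for w
  proof -
    have "nbs w = {x\<in>S. E x w}" using that sym_E by (auto simp: nbs_def S_def)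
    then show ?thesis using fS by (simp add: sum.inter_filter[symmetric] of_bool_def)
  qed
  have "deg x = card (nbs x \<inter> S) + of_bool (E x u) + of_bool (E x v)" for x
  proof -
    have "nbs x = (nbs x \<inter> S) \<union> ((if E x u then {u} else {}) \<union> (if E x v then {v} else {}))"
      using uv by (auto simp: nbs_def S_def)
    then have "deg x = card ((nbs x \<inter> S) \<union> ((if E x u then {u} else {}) \<union> (if E x v then {v} else {})))"
      by simp
    also have "\<dots> = card (nbs x \<inter> S) + card ((if E x u then {u} else {}) \<union> (if E x v then {v} else {}))"
      using uvS by (intro card_Un_disjoint) auto
    finally show ?thesis using uv by simp
  qed
  then have "(\<Sum>x\<in>S. deg x) = (\<Sum>x\<in>S. card (nbs x \<inter> S)) + deg u + deg v"
    using into[OF sub(1)] into[OF sub(2)] by (simp add: sum.distrib)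
  then have total: "(\<Sum>x\<in>V. deg x) = 2 * (deg u + deg v) + (\<Sum>x\<in>S. card (nbs x \<inter> S))"
    unfolding V_eq using uv uvS fS by simp
  have inner: "card (nbs x \<inter> S) + card (S - {x} - nbs x) = k - 1" if "x \<in> S" for x
  proof -
    have "S - {x} = (nbs x \<inter> S) \<union> (S - {x} - nbs x)" using irrefl_E by (auto simp: nbs_def)
    then have "card (S - {x}) = card ((nbs x \<inter> S) \<union> (S - {x} - nbs x))" by simp
    also have "\<dots> = card (nbs x \<inter> S) + card (S - {x} - nbs x)"
      using fS by (intro card_Un_disjoint) auto
    finally show ?thesis using that fS by (simp add: k_def)
  qed
  have inner_sum: "(\<Sum>x\<in>S. card (nbs x \<inter> S)) + (\<Sum>x\<in>S. card (S - {x} - nbs x)) = k * (k - 1)"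
    using inner by (simp add: sum.distrib[symmetric] k_def)
  have edges': "(k + 1) * k < 2 * (deg u + deg v) + (\<Sum>x\<in>S. card (nbs x \<inter> S))"
    using edges total by (simp add: cV)
  have "k \<noteq> 0"
  proof
    assume "k = 0"
    then have "S = {}" using fS by (simp add: k_def)
    then show False using edges' sub \<open>k = 0\<close> by simp
  qed
  then obtain m where m: "k = Suc m" by (cases k) auto
  have d: "deg u + deg v = k + 1"
    using edges' inner_sum small by (simp add: cV m)
  \<comment> \<open>Each missing edge inside \<open>S\<close> contributes 2 to this sum of codegrees, so none is missing.\<close>
  have "(\<Sum>x\<in>S. card (S - {x} - nbs x)) < 2"
    using edges' inner_sum d by (simp add: m)
  moreover have "2 \<le> (\<Sum>x\<in>S. card (S - {x} - nbs x))" if "a \<in> S" "b \<in> S" "a \<noteq> b" "\<not> E a b" for a b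
  proof -
    have "b \<in> S - {a} - nbs a" "a \<in> S - {b} - nbs b" using that E_commute by (auto simp: nbs_def)
    then have "1 \<le> card (S - {a} - nbs a)" "1 \<le> card (S - {b} - nbs b)"
      using fS by (metis One_nat_def Suc_leI card_gt_0_iff empty_iff finite_Diff)+
    then have "2 \<le> (\<Sum>x\<in>{a, b}. card (S - {x} - nbs x))" using that by simp
    also have "\<dots> \<le> (\<Sum>x\<in>S. card (S - {x} - nbs x))"
      using that fS by (intro sum_mono2) auto
    finally show ?thesis .
  qed
  ultimately have clique_S: "clique S" unfolding clique_def by (meson not_less)
  \<comment> \<open>If \<open>p\<close> is pendent, the other vertex is adjacent to all of \<open>S\<close>, giving the first exception.\<close>
  have not_one: "deg p \<noteq> 1" if "{p, q} = {u, v}" for p q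
  proof
    assume one: "deg p = 1"
    have pq: "p \<noteq> q" "p \<in> V" "q \<in> V" "V - {p} = insert q S" "nbs q \<subseteq> S" "deg p + deg q = k + 1"
      using that uv sub d by (auto simp: doubleton_eq_iff S_def)
    then have "nbs q = S" using one fS by (intro card_subset_eq) (auto simp: k_def)
    then have "clique (V - {p})"
      using clique_S pq E_commute by (auto simp: clique_def nbs_def)
    then show False using contra one pq by blast
  qed
  have le: "deg u \<le> k" "deg v \<le> k" using sub fS by (auto simp: k_def intro: card_mono)
  have "deg u \<noteq> 1" "deg v \<noteq> 1" using not_one[of u v] not_one[of v u] by auto
  then have two: "2 \<le> deg u" "2 \<le> deg v" using le d by linarith+
  have "nbs u \<inter> nbs v \<noteq> {}"
  proof
    assume "nbs u \<inter> nbs v = {}"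
    then have "card (nbs u \<union> nbs v) = k + 1" using d by (simp add: card_Un_disjoint)
    moreover have "card (nbs u \<union> nbs v) \<le> k" unfolding k_def using sub fS by (intro card_mono) auto
    ultimately show False by simp
  qed
  then obtain b where b: "b \<in> nbs u" "b \<in> nbs v" by blast
  have same: "a = c" if "a \<in> nbs u - {b}" "c \<in> nbs v - {b}" for a c
  proof (rule ccontr)
    assume ac: "a \<noteq> c"
    obtain rest where rest: "set rest = S - {a, b, c}" "distinct rest"
      using finite_distinct_list[of "S - {a, b, c}"] fS by blast
    have inS: "a \<in> S" "b \<in> S" "c \<in> S" using that b sub by auto
    have cl: "successively E (c # rest @ [a])"
      using rest ac inS clique_S
      by (intro successively_if_clique) (auto simp: clique_def)
    have "hamiltonian_circuit ([u, b, v] @ c # rest @ [a])"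
      unfolding hamiltonian_circuit_def
    proof (intro conjI)
      show "distinct ([u, b, v] @ c # rest @ [a])"
        using rest inS uv uvS ac that by auto
      show "set ([u, b, v] @ c # rest @ [a]) = V"
        using rest inS V_eq by auto
      show "successively E ([u, b, v] @ c # rest @ [a])"
        using cl that b E_commute by (auto simp: nbs_def)
      show "E (last ([u, b, v] @ c # rest @ [a])) (hd ([u, b, v] @ c # rest @ [a]))"
        using that sym_E by (auto simp: nbs_def)
    qed
    then show False using contra by blast
  qed
  \<comment> \<open>So \<open>u\<close> and \<open>v\<close> have exactly one further neighbour, and it is the same one.\<close>
  have "nbs u - {b} \<noteq> {}" "nbs v - {b} \<noteq> {}"
    using two card_mono[of "{b}" "nbs u"] card_mono[of "{b}" "nbs v"] by auto
  then obtain a where a: "nbs u - {b} = {a}" "nbs v - {b} = {a}" using same by blast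
  then have N: "nbs u = {a, b}" "nbs v = {a, b}" "a \<noteq> b" using b by auto
  then have "k = 3" using d by simp
  moreover have ab: "a \<in> S" "b \<in> S" using N sub by auto
  ultimately have "card (S - {a, b}) = 1" using fS N by (simp add: card_Diff_subset k_def)
  then obtain c where c: "S - {a, b} = {c}" by (rule card_1_singletonE)
  then have "c \<in> S - {a, b}" by simp
  then have cS: "c \<in> S" "\<not> E u c" "\<not> E v c"
    using N by (auto simp: nbs_def S_def)
  then have "independent {u, v, c}"
    using uv(4) irrefl_E sym_E unfolding independent_def by auto
  moreover have "card {u, v, c} = 3" "{u, v, c} \<subseteq> V"
    using cS uv uvS by (auto simp: S_def card_insert_if)
  ultimately show False using contra cV \<open>k = 3\<close> by auto
qed

end

section \<open>Paths in graphs with many edges\<close>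

text \<open>
  The cone over a graph is its join with one new vertex, the apex \<open>None\<close>.
\<close>

fun cone :: "('a \<Rightarrow> 'a \<Rightarrow> bool) \<Rightarrow> 'a option \<Rightarrow> 'a option \<Rightarrow> bool" where
  "cone E (Some x) (Some y) = E x y"
| "cone E None None = False"
| "cone E _ _ = True"

context adjacency
begin

abbreviation "cone_V \<equiv> insert None (Some ` V)"

interpretation cone: adjacency cone_V "cone E"
proof
  show "cone E x y \<Longrightarrow> cone E y x" for x y
    using sym_E by (cases x; cases y) auto
  show "\<not> cone E x x" for x using irrefl_E by (cases x) auto
qed (simp add: finite_V)

definition hamiltonian_path :: "'a list \<Rightarrow> bool" where
  "hamiltonian_path xs \<longleftrightarrow> distinct xs \<and> set xs = V \<and> successively E xs"

text \<open>
  Cutting the circuit at the apex \<open>None\<close> and joining the two pieces across its closing edge gives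
  the path.
\<close>

lemma hamiltonian_path_if_cone_circuit:
  assumes "cone.hamiltonian_circuit xs"
  shows "\<exists>ys. hamiltonian_path ys"
proof -
  have xs: "distinct xs" "set xs = cone_V" "successively (cone E) xs" "cone E (last xs) (hd xs)"
    using assms by (auto simp: cone.hamiltonian_circuit_def)
  obtain us vs where uv: "xs = us @ None # vs"
    using xs(2) by (metis insertI1 split_list)
  have succ: "successively (cone E) (vs @ us)"
  proof -
    have "successively (cone E) us" "successively (cone E) vs"
      using xs(3) unfolding uv by (auto simp: successively_append_iff successively_Cons)
    moreover have "cone E (last vs) (hd us)" if "us \<noteq> []" "vs \<noteq> []"
      using xs(4) that unfolding uv by simp
    ultimately show ?thesis by (auto simp: successively_append_iff)
  qed
  have set: "set (vs @ us) = Some ` V"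
  proof -
    have "insert None (set (vs @ us)) = cone_V" "None \<notin> set (vs @ us)"
      using xs(1,2) uv by auto
    then have "set (vs @ us) = cone_V - {None}" by blast
    then show ?thesis by auto
  qed
  then have "\<exists>ys. vs @ us = map Some ys" unfolding ex_map_conv by blast
  then obtain ys where eq: "vs @ us = map Some ys" ..
  have "successively E ys" using succ unfolding eq by (simp add: successively_map)
  moreover have "distinct (map Some ys)" using xs(1) uv by (auto simp: eq[symmetric])
  then have "distinct ys" by (simp add: distinct_map)
  moreover have "Some ` set ys = Some ` V" using set unfolding eq by simp
  then have "set ys = V" by (simp add: inj_image_eq_iff)
  ultimately show ?thesis by (auto simp: hamiltonian_path_def)
qed

lemma card_cone_V: "card cone_V = card V + 1"
  using finite_V by (simp add: card_image)

lemma deg_cone_None: "cone.deg None = card V"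
proof -
  have "cone.nbs None = Some ` V" by (auto simp: cone.nbs_def)
  then show ?thesis by (simp add: card_image)
qed

lemma deg_cone_Some: "cone.deg (Some x) = deg x + 1"
proof -
  have "cone.nbs (Some x) = insert None (Some ` nbs x)" by (auto simp: cone.nbs_def nbs_def)
  then show ?thesis by (simp add: card_image)
qed

text \<open>
  Apply the circuit theorem to the cone. The apex has degree at least 2 and is adjacent to every
  other vertex, so it is neither the pendent vertex nor a member of the independent set, and both
  exceptions descend to the graph itself.
\<close>

theorem hamiltonian_path_if_many_edges:
  assumes V: "2 \<le> card V" and edges: "(card V - 1) * (card V - 2) \<le> (\<Sum>x\<in>V. deg x)"
  shows "(\<exists>xs. hamiltonian_path xs) \<or>
    (\<exists>w\<in>V. deg w = 0 \<and> clique (V - {w})) \<or>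
    (card V = 4 \<and> (\<exists>T\<subseteq>V. card T = 3 \<and> independent T))"
proof -
  obtain m where m: "card V = m + 2" using V by (metis add.commute le_Suc_ex)
  have "(\<Sum>x\<in>cone_V. cone.deg x) = (\<Sum>x\<in>V. deg x) + 2 * card V"
    using finite_V by (simp add: deg_cone_None deg_cone_Some sum.reindex sum_Suc)
  then have "(card cone_V - 1) * (card cone_V - 2) < (\<Sum>x\<in>cone_V. cone.deg x)"
    using edges by (simp add: card_cone_V m)
  moreover have "2 \<le> card cone_V" using V by (simp add: card_cone_V)
  ultimately consider xs where "cone.hamiltonian_circuit xs"
    | w where "w \<in> cone_V" "cone.deg w = 1" "cone.clique (cone_V - {w})"
    | T where "card cone_V = 5" "T \<subseteq> cone_V" "card T = 3" "cone.independent T"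
    using cone.hamiltonian_if_many_edges by blast
  then show ?thesis
  proof cases
    case 1
    then show ?thesis using hamiltonian_path_if_cone_circuit by blast
  next
    case 2
    then obtain x where x: "w = Some x" "x \<in> V" using V by (auto simp: deg_cone_None)
    moreover have "clique (V - {x})"
      unfolding clique_def
    proof (intro ballI impI)
      fix a b assume "a \<in> V - {x}" "b \<in> V - {x}" "a \<noteq> b"
      then show "E a b" using 2(3) x unfolding cone.clique_def
        by (metis DiffD1 DiffD2 DiffI cone.simps(1) imageI insertCI option.inject singletonD singletonI)
    qed
    ultimately show ?thesis using 2 by (auto simp: deg_cone_Some)
  next
    case 3
    have "T \<noteq> {None}" "T \<noteq> {}" using \<open>card T = 3\<close> by auto
    then obtain y where y: "Some y \<in> T" by (metis not_None_eq subset_singleton_iff subsetI singletonI)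
    then have "None \<notin> T" using 3(4) unfolding cone.independent_def by (metis cone.simps(3))
    then have "T \<subseteq> Some ` V" using 3(2) by auto
    then obtain T' where T': "T = Some ` T'" "T' \<subseteq> V" by (metis subset_image_iff)
    then have "card T' = 3" "independent T'"
      using 3 by (auto simp: card_image independent_def cone.independent_def)
    then show ?thesis using 3 T' by (auto simp: card_cone_V)
  qed
qed

end

section \<open>Eigenvalues\<close>

context adjacency
begin

definition eigenfunction :: "real \<Rightarrow> ('a \<Rightarrow> real) \<Rightarrow> bool" where
  "eigenfunction k x \<longleftrightarrow> (\<exists>u\<in>V. x u \<noteq> 0) \<and> (\<forall>u\<in>V. (\<Sum>w\<in>nbs u. x w) = k * x u)"

lemma eigenfunction_scale:
  assumes "eigenfunction k x" "c \<noteq> 0"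
  shows "eigenfunction k (\<lambda>u. c * x u)"
proof -
  have "(\<Sum>w\<in>nbs u. c * x w) = k * (c * x u)" if "u \<in> V" for u
    using assms that unfolding sum_distrib_left[symmetric] eigenfunction_def by simp
  then show ?thesis using assms by (auto simp: eigenfunction_def)
qed

text \<open>
  Scaling so that the largest quotient of \<open>x\<close> and \<open>y\<close> becomes 1. After this normalisation an upper
  bound for an eigenvalue is read off at the touching vertex \<open>u\<close>, whatever the signs of the other
  entries.
\<close>

lemma eigenfunction_dominated:
  assumes x: "eigenfunction k x" and y: "\<And>u. u \<in> V \<Longrightarrow> 0 < y u"
  obtains z u where "eigenfunction k z" "u \<in> V" "z u = y u" "\<And>w. w \<in> V \<Longrightarrow> z w \<le> y w"
proof -
  obtain x' u0 where x': "eigenfunction k x'" "u0 \<in> V" "0 < x' u0"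
  proof -
    obtain u0 where u0: "u0 \<in> V" "x u0 \<noteq> 0" using x by (auto simp: eigenfunction_def)
    show thesis
    proof (cases "0 < x u0")
      case True
      then show ?thesis using that[of x u0] x u0 by simp
    next
      case False
      then show ?thesis using that[of "\<lambda>u. - 1 * x u" u0] eigenfunction_scale[OF x, of "- 1"] u0 by simp
    qed
  qed
  define r where "r u = x' u / y u" for u
  have V: "V \<noteq> {}" using x' by auto
  have "Max (r ` V) \<in> r ` V" using V finite_V by (intro Max_in) auto
  then obtain u where u: "Max (r ` V) = r u" "u \<in> V" by (rule imageE)
  have max: "r w \<le> r u" if "w \<in> V" for w
    unfolding u(1)[symmetric] using that finite_V by (intro Max_ge) auto
  have ru: "0 < r u"
    using max[OF x'(2)] x' y[OF x'(2)] by (smt (verit) divide_pos_pos r_def)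
  show thesis
  proof (rule that[of "\<lambda>w. inverse (r u) * x' w" u])
    show "eigenfunction k (\<lambda>w. inverse (r u) * x' w)"
      using ru by (intro eigenfunction_scale[OF x'(1)]) simp
    show "u \<in> V" by fact
    show "inverse (r u) * x' u = y u"
      using ru y[OF u(2)] unfolding r_def by (auto simp: field_simps)
    show "inverse (r u) * x' w \<le> y w" if "w \<in> V" for w
      using max[OF that] ru y[OF that] unfolding r_def[of w] by (simp add: field_simps)
  qed
qed

text \<open>
  The Collatz--Wielandt bound.
\<close>

lemma eigenvalue_le_weighted:
  assumes x: "eigenfunction k x" and y: "\<And>u. u \<in> V \<Longrightarrow> 0 < y u"
    and c: "\<And>u. u \<in> V \<Longrightarrow> (\<Sum>w\<in>nbs u. y w) \<le> c * y u"
  shows "k \<le> c"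
proof -
  obtain z u where z: "eigenfunction k z" "u \<in> V" "z u = y u" "\<And>w. w \<in> V \<Longrightarrow> z w \<le> y w"
    using eigenfunction_dominated[OF x, of y] y by blast
  have "k * y u = (\<Sum>w\<in>nbs u. z w)" using z by (simp add: eigenfunction_def)
  also have "\<dots> \<le> (\<Sum>w\<in>nbs u. y w)" using z by (intro sum_mono) (auto simp: nbs_def)
  also have "\<dots> \<le> c * y u" using c z by simp
  finally show ?thesis using y[OF z(2)] by simp
qed

text \<open>
  At a vertex \<open>u\<close> where the eigenfunction \<open>z\<close> takes its maximum 1, \<open>k\<^sup>2\<close> is the sum of \<open>z\<close> over the
  ends of the walks of length 2 from \<open>u\<close>, and \<open>k\<close> is its sum over the neighbours of \<open>u\<close>. Bounding
  \<open>z\<close> by 1 gives the degrees of the neighbours and of \<open>u\<close>, which belong to distinct vertices since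
  \<open>u\<close> is not its own neighbour.
\<close>

lemma eigenvalue_le_degree_sum:
  assumes x: "eigenfunction k x"
  shows "k\<^sup>2 + k \<le> (\<Sum>v\<in>V. real (deg v))"
proof -
  obtain z u where z: "eigenfunction k z" "u \<in> V" "z u = 1" "\<And>w. w \<in> V \<Longrightarrow> z w \<le> 1"
    using eigenfunction_dominated[OF x, of "\<lambda>_. 1"] by auto
  have eq: "k * z w = (\<Sum>v\<in>nbs w. z v)" if "w \<in> V" for w
    using z that by (simp add: eigenfunction_def)
  have nV: "nbs w \<subseteq> V" for w by (auto simp: nbs_def)
  have k: "k = (\<Sum>w\<in>nbs u. z w)" using eq[of u] z by simp
  have "k\<^sup>2 = (\<Sum>w\<in>nbs u. k * z w)"
    using k by (simp add: power2_eq_square sum_distrib_left[symmetric])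
  also have "\<dots> = (\<Sum>w\<in>nbs u. \<Sum>v\<in>nbs w. z v)"
    using eq nV by (intro sum.cong) auto
  also have "\<dots> \<le> (\<Sum>w\<in>nbs u. \<Sum>v\<in>nbs w. 1)"
    using z nV by (intro sum_mono) blast
  finally have k2: "k\<^sup>2 \<le> (\<Sum>w\<in>nbs u. real (deg w))" by simp
  have "k \<le> (\<Sum>w\<in>nbs u. 1)" unfolding k using z nV by (intro sum_mono) blast
  moreover have "u \<notin> nbs u" using irrefl_E by (simp add: nbs_def)
  ultimately have "k\<^sup>2 + k \<le> (\<Sum>w\<in>insert u (nbs u). real (deg w))"
    using k2 by simp
  also have "\<dots> \<le> (\<Sum>v\<in>V. real (deg v))"
    using z nV finite_V by (intro sum_mono2) auto
  finally show ?thesis .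
qed

text \<open>
  The weighted bound for weights \<open>\<alpha>\<close> outside and \<open>\<beta>\<close> inside an independent set. The extremal case
  joins every vertex outside the set to all other vertices.
\<close>

lemma eigenvalue_independent:
  assumes x: "eigenfunction k x" and T: "T \<subseteq> V" "independent T"
    and pos: "0 < \<alpha>" "0 < \<beta>"
    and outside: "real (card (V - T) - 1) * \<alpha> + real (card T) * \<beta> \<le> c * \<alpha>"
    and inside: "real (card (V - T)) * \<alpha> \<le> c * \<beta>"
  shows "k \<le> c"
proof (rule eigenvalue_le_weighted[OF x])
  define y where "y u = (if u \<in> T then \<beta> else \<alpha>)" for u
  show "0 < y u" for u using pos by (simp add: y_def)
  fix u assume u: "u \<in> V"
  have fT: "finite T" using T finite_V finite_subset by blast
  show "(\<Sum>w\<in>nbs u. y w) \<le> c * y u"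
  proof (cases "u \<in> T")
    case True
    have "(\<Sum>w\<in>nbs u. y w) \<le> (\<Sum>w\<in>V - T. y w)"
      using T True pos finite_V
      by (intro sum_mono2) (auto simp: nbs_def independent_def y_def)
    also have "\<dots> = real (card (V - T)) * \<alpha>" by (simp add: y_def)
    finally show ?thesis using inside True by (simp add: y_def)
  next
    case False
    have "(\<Sum>w\<in>nbs u. y w) \<le> (\<Sum>w\<in>(V - T - {u}) \<union> T. y w)"
      using T pos finite_V fT irrefl_E
      by (intro sum_mono2) (auto simp: nbs_def y_def)
    also have "\<dots> = (\<Sum>w\<in>V - T - {u}. y w) + (\<Sum>w\<in>T. y w)"
      using finite_V fT by (intro sum.union_disjoint) auto
    also have "\<dots> = real (card (V - T) - 1) * \<alpha> + real (card T) * \<beta>"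
      using u False finite_V by (simp add: y_def)
    finally show ?thesis using outside False by (simp add: y_def)
  qed
qed

end

text \<open>
  A complex eigenvalue \<open>c\<close> exists. The Hermitian form \<open>q\<close> of the matrix, evaluated at its
  eigenvector, is real by symmetry and equals \<open>c\<close> times the squared norm, so \<open>c\<close> is real. Then the
  real and the imaginary part of the eigenvector satisfy the same equation, and one of them is
  nonzero.
\<close>

lemma spectrum_nonempty_if_symmetric:
  fixes A :: "real mat"
  assumes A: "A \<in> carrier_mat n n" and n: "0 < n"
    and sym: "\<And>i j. \<lbrakk>i < n; j < n\<rbrakk> \<Longrightarrow> A $$ (i, j) = A $$ (j, i)"
  shows "spectrum A \<noteq> {}"
proof -
  let ?C = "map_mat complex_of_real A"
  have C: "?C \<in> carrier_mat n n" using A by simp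
  obtain c v where v: "eigenvector ?C v c"
    using spectrum_non_empty[OF C n] by (auto simp: spectrum_def eigenvalue_def)
  then have dim: "dim_vec v = n" and nz: "v \<noteq> 0\<^sub>v n" and eq: "?C *\<^sub>v v = c \<cdot>\<^sub>v v"
    using A by (auto simp: eigenvector_def)
  have row: "(\<Sum>j<n. A $$ (i, j) * v $ j) = c * v $ i" if "i < n" for i
  proof -
    have "(?C *\<^sub>v v) $ i = (\<Sum>j<n. A $$ (i, j) * v $ j)"
      using that A dim by (simp add: scalar_prod_def atLeast0LessThan)
    then show ?thesis using that dim by (simp add: eq)
  qed
  define q where "q = (\<Sum>i<n. \<Sum>j<n. A $$ (i, j) * cnj (v $ i) * v $ j)"
  define s where "s = (\<Sum>i<n. (cmod (v $ i))\<^sup>2)"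
  have "q = (\<Sum>i<n. cnj (v $ i) * (\<Sum>j<n. A $$ (i, j) * v $ j))"
    unfolding q_def by (simp add: sum_distrib_left mult_ac)
  also have "\<dots> = (\<Sum>i<n. c * (v $ i * cnj (v $ i)))"
    using row by (intro sum.cong) (auto simp: mult_ac)
  also have "\<dots> = c * of_real s"
    by (simp add: s_def sum_distrib_left complex_norm_square[symmetric])
  finally have q: "q = c * of_real s" .
  have "cnj q = (\<Sum>i<n. \<Sum>j<n. A $$ (j, i) * v $ i * cnj (v $ j))"
    using sym by (auto simp: q_def intro!: sum.cong)
  also have "\<dots> = q"
    unfolding q_def by (subst sum.swap) (simp add: mult_ac)
  finally have "cnj c * of_real s = c * of_real s" using q by simp
  moreover have "s \<noteq> 0"
  proof
    assume "s = 0"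
    then have "v $ i = 0" if "i < n" for i
      using that by (simp add: s_def sum_nonneg_eq_0_iff)
    then have "v = 0\<^sub>v n" using dim by (intro eq_vecI) auto
    then show False using nz by simp
  qed
  ultimately have "cnj c = c" by simp
  then obtain k where k: "c = of_real k" by (metis Reals_cases Reals_cnj_iff)
  have eig: "k \<in> spectrum A" if x: "\<And>i. i < n \<Longrightarrow> (\<Sum>j<n. A $$ (i, j) * x j) = k * x i"
    and i: "i < n" "x i \<noteq> 0" for x i
  proof -
    have "vec n x $ i \<noteq> 0" using i by simp
    then have "vec n x \<noteq> 0\<^sub>v n" using index_zero_vec(1)[OF i(1)] by force
    moreover have "A *\<^sub>v vec n x = k \<cdot>\<^sub>v vec n x"
      using A x by (intro eq_vecI) (auto simp: scalar_prod_def atLeast0LessThan)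
    ultimately show ?thesis
      using A unfolding spectrum_def eigenvalue_def eigenvector_def
      by (auto intro!: exI[of _ "vec n x"])
  qed
  obtain i where i: "i < n" "v $ i \<noteq> 0"
    using nz dim by (metis eq_vecI index_zero_vec)
  then consider "Re (v $ i) \<noteq> 0" | "Im (v $ i) \<noteq> 0" by (auto simp: complex_eq_iff)
  then show ?thesis
  proof cases
    case 1
    have "(\<Sum>j<n. A $$ (i, j) * Re (v $ j)) = k * Re (v $ i)" if "i < n" for i
      using arg_cong[OF row[OF that], of Re] by (simp add: k)
    then show ?thesis using eig[of "\<lambda>j. Re (v $ j)" i] i 1 by auto
  next
    case 2
    have "(\<Sum>j<n. A $$ (i, j) * Im (v $ j)) = k * Im (v $ i)" if "i < n" for i
      using arg_cong[OF row[OF that], of Im] by (simp add: k)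
    then show ?thesis using eig[of "\<lambda>j. Im (v $ j)" i] i 2 by auto
  qed
qed

section \<open>Walks and isomorphisms\<close>

lemma bij_betw_fun_upd_insert:
  assumes "bij_betw f A B" "a \<notin> A" "b \<notin> B"
  shows "bij_betw (f(a := b)) (insert a A) (insert b B)"
  using assms by (auto simp: bij_betw_def inj_on_fun_updI)

lemma (in wf_digraph) awalk_of_vertex_list:
  assumes "xs \<noteq> []" "set xs \<subseteq> verts G" "successively (dominates G) xs"
  shows "\<exists>p. awalk (hd xs) p (last xs) \<and> awalk_verts (hd xs) p = xs"
  using assms
proof (induction xs rule: induct_list012)
  case (2 x)
  then show ?case by (intro exI[of _ "[]"]) (simp add: awalk_Nil_iff)
next
  case (3 x y zs)
  then obtain p where p: "awalk y p (last (y # zs))" "awalk_verts y p = y # zs" by auto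
  obtain e where "e \<in> arcs G" "tail G e = x" "head G e = y"
    using "3.prems" by auto
  then show ?case using p by (intro exI[of _ "e # p"]) (simp add: awalk_Cons_iff)
qed auto

lemma (in graph) adjacency: "adjacency (verts G) (dominates G)"
proof
  show "v \<rightarrow>\<^bsub>G\<^esub> u" if "u \<rightarrow>\<^bsub>G\<^esub> v" for u v using arcs_ends_symmetric[OF sym_arcs that] .
  show "\<not> u \<rightarrow>\<^bsub>G\<^esub> u" for u using adj_not_same by blast
qed simp

lemma (in graph) digraph_iso_pair:
  assumes f: "bij_betw f (verts G) (pverts H)"
    and H: "parcs H \<subseteq> pverts H \<times> pverts H"
    and arcs: "\<And>u v. \<lbrakk>u \<in> verts G; v \<in> verts G\<rbrakk> \<Longrightarrow> u \<rightarrow>\<^bsub>G\<^esub> v \<longleftrightarrow> (f u, f v) \<in> parcs H"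
  shows "digraph_iso G (with_proj H)"
proof -
  define h where "h = \<lparr> iso_verts = f, iso_arcs = \<lambda>a. (f (tail G a), f (head G a)),
    iso_head = snd, iso_tail = fst \<rparr>"
  have inj: "inj_on f (verts G)" and img: "f ` verts G = pverts H"
    using f by (auto simp: bij_betw_def)
  have "inj_on (iso_arcs h) (arcs G)"
  proof (rule inj_onI)
    fix a b assume ab: "a \<in> arcs G" "b \<in> arcs G" "iso_arcs h a = iso_arcs h b"
    then have "arc_to_ends G a = arc_to_ends G b"
      using inj by (auto simp: h_def arc_to_ends_def inj_on_eq_iff)
    then show "a = b" using no_multi_arcs ab by blast
  qed
  then have "digraph_isomorphism h"
    using inj wf_digraph by (simp add: digraph_isomorphism_def h_def)
  moreover have "parcs H = iso_arcs h ` arcs G"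
  proof (intro subset_antisym subsetI)
    fix e assume e: "e \<in> parcs H"
    then obtain u v where uv: "e = (f u, f v)" "u \<in> verts G" "v \<in> verts G"
      using H img by blast
    then have "u \<rightarrow>\<^bsub>G\<^esub> v" using e arcs by blast
    then show "e \<in> iso_arcs h ` arcs G" using uv by (auto simp: h_def)
  next
    fix e assume "e \<in> iso_arcs h ` arcs G"
    then obtain a where a: "a \<in> arcs G" "e = (f (tail G a), f (head G a))" by (auto simp: h_def)
    then have "tail G a \<rightarrow>\<^bsub>G\<^esub> head G a" by (auto simp: arcs_ends_conv)
    then show "e \<in> parcs H" using arcs a by simp
  qed
  then have "with_proj H = app_iso h G"
    using img by (simp add: app_iso_def with_proj_def h_def)
  ultimately show ?thesis unfolding digraph_iso_def by blast
qed

section \<open>Graphs with large spectral radius\<close>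

context graph
begin

interpretation A: adjacency "verts G" "dominates G" by (rule adjacency)

lemma eigenfunction_graph_spectral_radius:
  assumes "verts G \<noteq> {}"
  shows "\<exists>x. A.eigenfunction (graph_spectral_radius G) x"
proof -
  obtain vs where vs: "distinct vs" "set vs = verts G"
    using finite_distinct_list[OF finite_verts] by blast
  let ?M = "adjacency_matrix G vs"
  have M: "?M \<in> carrier_mat (length vs) (length vs)" by (simp add: adjacency_matrix_def)
  have "spectrum ?M \<noteq> {}"
    using assms vs A.E_commute
    by (intro spectrum_nonempty_if_symmetric[OF M]) (auto simp: adjacency_matrix_def)
  then have "Max (spectrum ?M) \<in> spectrum ?M"
    using card_finite_spectrum(1)[OF M] Max_in by blast
  then have "graph_spectral_radius G \<in> spectrum ?M"
    by (simp add: graph_spectral_radius_def adjacency_spectrum_eq[OF vs])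
  then show ?thesis
    unfolding spectrum_adjacency_matrix[OF vs] A.eigenfunction_def A.nbs_def
    by (simp add: sum.inter_filter)
qed

lemma has_hamiltonian_path_if:
  assumes xs: "A.hamiltonian_path xs" and "verts G \<noteq> {}"
  shows has_hamiltonian_path
proof -
  have "xs \<noteq> []" using assms by (auto simp: A.hamiltonian_path_def)
  then obtain p where "awalk (hd xs) p (last xs)" "awalk_verts (hd xs) p = xs"
    using awalk_of_vertex_list[of xs] xs by (auto simp: A.hamiltonian_path_def)
  then show ?thesis
    using xs unfolding has_hamiltonian_path_def apath_def A.hamiltonian_path_def by metis
qed

lemma has_hamiltonian_cycle_if:
  assumes xs: "A.hamiltonian_circuit xs" and V: "3 \<le> card (verts G)"
  shows has_hamiltonian_cycle
proof -
  have len: "3 \<le> length xs"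
    using xs V distinct_card[of xs] by (auto simp: A.hamiltonian_circuit_def)
  then have ne: "xs \<noteq> []" by auto
  let ?ys = "xs @ [hd xs]"
  have "successively (dominates G) ?ys"
    using xs by (simp add: A.hamiltonian_circuit_def successively_append_iff)
  moreover have set_ys: "set ?ys = verts G"
    using xs hd_in_set[OF ne] by (simp add: A.hamiltonian_circuit_def insert_absorb)
  ultimately obtain p where "awalk (hd ?ys) p (last ?ys)" "awalk_verts (hd ?ys) p = ?ys"
    using awalk_of_vertex_list[of ?ys] by blast
  then have p: "awalk (hd xs) p (hd xs)" "awalk_verts (hd xs) p = ?ys"
    using ne by simp_all
  have "length p = length xs"
    using p length_awalk_verts[of "hd xs" p] by simp
  then have "3 \<le> length p" "p \<noteq> []" using len by auto
  moreover have "distinct (tl ?ys)"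
    using xs ne by (cases xs) (simp_all add: A.hamiltonian_circuit_def)
  ultimately show ?thesis
    using p set_ys unfolding has_hamiltonian_cycle_def cycle_def by metis
qed

lemma iso_complete_plus_vertex:
  assumes w: "w \<in> verts G" "A.deg w = 0" and clique: "A.clique (verts G - {w})"
  shows "digraph_iso G (with_proj (complete_plus_vertex (card (verts G) - 1)))"
proof -
  let ?m = "card (verts G) - 1"
  have "card (verts G - {w}) = ?m" using w by simp
  then obtain f where f: "bij_betw f (verts G - {w}) {..<?m}"
    using ex_bij_betw_finite_nat[of "verts G - {w}"] by (auto simp: atLeast0LessThan)
  let ?f = "f(w := ?m)"
  have fv: "u \<in> verts G \<Longrightarrow> u \<noteq> w \<Longrightarrow> f u < ?m" for u using f by (auto simp: bij_betw_def)
  have fe: "u \<in> verts G \<Longrightarrow> v \<in> verts G \<Longrightarrow> u \<noteq> w \<Longrightarrow> v \<noteq> w \<Longrightarrow> f u = f v \<longleftrightarrow> u = v" for u v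
    using f by (auto simp: bij_betw_def inj_on_eq_iff)
  have iso: "\<not> w \<rightarrow>\<^bsub>G\<^esub> u" "\<not> u \<rightarrow>\<^bsub>G\<^esub> w" for u
    using w A.E_commute adj_in_verts(2) unfolding A.nbs_def by (auto; blast)+
  show ?thesis
  proof (rule digraph_iso_pair)
    have "bij_betw ?f (insert w (verts G - {w})) (insert ?m {..<?m})"
      using f by (intro bij_betw_fun_upd_insert) auto
    then show "bij_betw ?f (verts G) (pverts (complete_plus_vertex ?m))"
      using w by (simp add: complete_plus_vertex_def complete_graph_def insert_absorb)
    show "u \<rightarrow>\<^bsub>G\<^esub> v \<longleftrightarrow> (?f u, ?f v) \<in> parcs (complete_plus_vertex ?m)"
      if "u \<in> verts G" "v \<in> verts G" for u v
      using that iso fv fe clique A.irrefl_E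
      by (auto simp: complete_plus_vertex_def complete_graph_def A.clique_def)
  qed (auto simp: complete_plus_vertex_def complete_graph_def)
qed

lemma iso_complete_plus_edge:
  assumes w: "w \<in> verts G" "A.deg w = 1" and clique: "A.clique (verts G - {w})"
  shows "digraph_iso G (with_proj (complete_plus_edge (card (verts G) - 1)))"
proof -
  let ?m = "card (verts G) - 1"
  obtain c where c: "A.nbs w = {c}" using w(2) by (rule card_1_singletonE)
  then have cw: "c \<in> verts G" "c \<noteq> w" using A.irrefl_E by (auto simp: A.nbs_def)
  have adj: "w \<rightarrow>\<^bsub>G\<^esub> u \<longleftrightarrow> u = c" "u \<rightarrow>\<^bsub>G\<^esub> w \<longleftrightarrow> u = c" for u
    using c A.E_commute adj_in_verts(2) unfolding A.nbs_def by blast+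
  have "card (verts G - {w}) = ?m" using w by simp
  then obtain g where g: "bij_betw g (verts G - {w}) {..<?m}"
    using ex_bij_betw_finite_nat[of "verts G - {w}"] by (auto simp: atLeast0LessThan)
  have gc: "g c < ?m" using g cw by (auto simp: bij_betw_def)
  \<comment> \<open>The pendent edge of the model ends at 0, so the neighbour \<open>c\<close> of \<open>w\<close> has to be sent there.\<close>
  define f where "f = transpose 0 (g c) \<circ> g"
  have f: "bij_betw f (verts G - {w}) {..<?m}"
    unfolding f_def using gc by (intro bij_betw_trans[OF g] bij_betw_transpose_iff) auto
  have f0: "f c = 0" by (simp add: f_def)
  let ?f = "f(w := ?m)"
  have fv: "u \<in> verts G \<Longrightarrow> u \<noteq> w \<Longrightarrow> f u < ?m" for u using f by (auto simp: bij_betw_def)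
  have fe: "u \<in> verts G \<Longrightarrow> v \<in> verts G \<Longrightarrow> u \<noteq> w \<Longrightarrow> v \<noteq> w \<Longrightarrow> f u = f v \<longleftrightarrow> u = v" for u v
    using f by (auto simp: bij_betw_def inj_on_eq_iff)
  have fc: "u \<in> verts G \<Longrightarrow> u \<noteq> w \<Longrightarrow> f u = 0 \<longleftrightarrow> u = c" for u
    using fe[of u c] cw f0 by simp
  have m0: "0 < ?m" using gc by simp
  show ?thesis
  proof (rule digraph_iso_pair)
    have "bij_betw ?f (insert w (verts G - {w})) (insert ?m {..<?m})"
      using f by (intro bij_betw_fun_upd_insert) auto
    then show "bij_betw ?f (verts G) (pverts (complete_plus_edge ?m))"
      using w by (simp add: complete_plus_edge_def complete_graph_def insert_absorb)
    show "u \<rightarrow>\<^bsub>G\<^esub> v \<longleftrightarrow> (?f u, ?f v) \<in> parcs (complete_plus_edge ?m)"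
      if "u \<in> verts G" "v \<in> verts G" for u v
      using that adj cw fv[of u] fv[of v] fe[of u v] fc m0 clique A.irrefl_E
      by (auto simp: complete_plus_edge_def complete_graph_def A.clique_def)
  qed (use m0 in \<open>auto simp: complete_plus_edge_def complete_graph_def\<close>)
qed

text \<open>
  A graph of order 4 with three independent vertices has spectral radius at most that of the star,
  the square root of 3. The weights 9 and 5 approximate its eigenvector closely enough to stay
  below 2.
\<close>

lemma hamiltonian_path_if_spectral_radius:
  assumes V: "2 \<le> card (verts G)" and mu: "real (card (verts G)) - 2 \<le> graph_spectral_radius G"
    and iso: "\<not> digraph_iso G (with_proj (complete_plus_vertex (card (verts G) - 1)))"
  shows has_hamiltonian_path
proof -
  have ne: "verts G \<noteq> {}" using V by auto
  obtain x where x: "A.eigenfunction (graph_spectral_radius G) x"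
    using eigenfunction_graph_spectral_radius[OF ne] by blast
  let ?mu = "graph_spectral_radius G"
  obtain m where m: "card (verts G) = m + 2" using V by (metis add.commute le_Suc_ex)
  have "real m * real m \<le> ?mu * ?mu" using mu m by (intro mult_mono) auto
  then have "real ((m + 1) * m) \<le> real (\<Sum>v\<in>verts G. A.deg v)"
    using A.eigenvalue_le_degree_sum[OF x] mu m by (simp add: power2_eq_square algebra_simps)
  then have "(m + 1) * m \<le> (\<Sum>v\<in>verts G. A.deg v)" by (simp only: of_nat_le_iff)
  then have "(card (verts G) - 1) * (card (verts G) - 2) \<le> (\<Sum>v\<in>verts G. A.deg v)"
    by (simp add: m)
  from A.hamiltonian_path_if_many_edges[OF V this]
  consider xs where "A.hamiltonian_path xs"
    | w where "w \<in> verts G" "A.deg w = 0" "A.clique (verts G - {w})"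
    | T where "card (verts G) = 4" "T \<subseteq> verts G" "card T = 3" "A.independent T"
    by blast
  then show ?thesis
  proof cases
    case 1
    then show ?thesis using has_hamiltonian_path_if ne by blast
  next
    case 2
    then show ?thesis using iso_complete_plus_vertex iso by blast
  next
    case 3
    then have "card (verts G - T) = 1" by (simp add: card_Diff_subset finite_subset[OF 3(2)])
    then have "?mu \<le> 9 / 5"
      using A.eigenvalue_independent[OF x 3(2,4), of 9 5 "9 / 5"] 3(3) by simp
    then show ?thesis using mu 3(1) by simp
  qed
qed

text \<open>
  For order 5 and three independent vertices, the weights 3 and 2 are the eigenvector of the
  extremal graph for its eigenvalue 3. In order 2 a circuit is a single edge and not a cycle; that
  graph is \<open>K\<^sub>1 + e\<close>.
\<close>

lemma hamiltonian_cycle_if_spectral_radius: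
  assumes V: "2 \<le> card (verts G)" and mu: "real (card (verts G)) - 2 < graph_spectral_radius G"
    and iso: "\<not> digraph_iso G (with_proj (complete_plus_edge (card (verts G) - 1)))"
  shows has_hamiltonian_cycle
proof -
  have ne: "verts G \<noteq> {}" using V by auto
  obtain x where x: "A.eigenfunction (graph_spectral_radius G) x"
    using eigenfunction_graph_spectral_radius[OF ne] by blast
  let ?mu = "graph_spectral_radius G"
  obtain m where m: "card (verts G) = m + 2" using V by (metis add.commute le_Suc_ex)
  have "real m * real m \<le> ?mu * ?mu" using mu m by (intro mult_mono) auto
  then have "real ((m + 1) * m) < real (\<Sum>v\<in>verts G. A.deg v)"
    using A.eigenvalue_le_degree_sum[OF x] mu m by (simp add: power2_eq_square algebra_simps)
  then have "(m + 1) * m < (\<Sum>v\<in>verts G. A.deg v)" by (simp only: of_nat_less_iff)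
  then have "(card (verts G) - 1) * (card (verts G) - 2) < (\<Sum>v\<in>verts G. A.deg v)"
    by (simp add: m)
  from A.hamiltonian_if_many_edges[OF V this]
  consider xs where "A.hamiltonian_circuit xs"
    | w where "w \<in> verts G" "A.deg w = 1" "A.clique (verts G - {w})"
    | T where "card (verts G) = 5" "T \<subseteq> verts G" "card T = 3" "A.independent T"
    by blast
  then show ?thesis
  proof cases
    case 1
    have "m \<noteq> 0"
    proof
      assume "m = 0"
      define a b where "a = last xs" and "b = hd xs"
      have ab: "a \<rightarrow>\<^bsub>G\<^esub> b"
        using 1 unfolding A.hamiltonian_circuit_def a_def b_def by blast
      then have ab_in: "a \<in> verts G" "b \<in> verts G" by (rule adj_in_verts)+
      have "a \<noteq> b" using ab A.irrefl_E by auto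
      then have "verts G = {a, b}"
        using ab_in m \<open>m = 0\<close> by (intro card_subset_eq[symmetric]) auto
      then have V_iff: "x \<in> verts G \<longleftrightarrow> x = a \<or> x = b" for x by simp
      have "A.nbs a = {b}" "A.clique (verts G - {a})"
        using ab A.irrefl_E by (auto simp: A.nbs_def A.clique_def V_iff)
      then show False using iso_complete_plus_edge[of a] ab_in iso by simp
    qed
    then show ?thesis using 1 has_hamiltonian_cycle_if m by simp
  next
    case 2
    then show ?thesis using iso_complete_plus_edge iso by blast
  next
    case 3
    then have "card (verts G - T) = 2" by (simp add: card_Diff_subset finite_subset[OF 3(2)])
    then have "?mu \<le> 3"
      using A.eigenvalue_independent[OF x 3(2,4), of 3 2 3] 3(3) by simp
    then show ?thesis using mu 3(1) by simp
  qed
qed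

end

theorem theorem1:
  fixes G :: "('a, 'b) pre_digraph" and n :: nat
  assumes "graph G" and "card (verts G) = n" and "n \<ge> 2"
  shows "(graph_spectral_radius G \<ge> real n - 2 \<longrightarrow>
            \<not> digraph_iso G (with_proj (complete_plus_vertex (n - 1))) \<longrightarrow>
            pre_digraph.has_hamiltonian_path G) \<and>
         (graph_spectral_radius G > real n - 2 \<longrightarrow>
            \<not> digraph_iso G (with_proj (complete_plus_edge (n - 1))) \<longrightarrow>
            pre_digraph.has_hamiltonian_cycle G)"
proof -
  interpret graph G by fact
  show ?thesis
    using hamiltonian_path_if_spectral_radius hamiltonian_cycle_if_spectral_radius assms(3)
    unfolding assms(2) by simp
qed

end
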